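(* Let $ABC$ be a triangle. There are infinitely many points $P$, not on the extended sides of $ABC$ or of $K^{-1}(ABC)$, whose barycentric coordinates with respect to $ABC$ can be taken to lie in the quadratic field $\mathbb{Q}(\sqrt2)$ and for which the map $\mathsf{M}=T_P\circ K^{-1}\circ T_{P'}$ is a translation.
   Context: Work in the extended Euclidean plane (the Euclidean plane together with the line at infinity $l_\infty$). $ABC$ is an ordinary triangle with centroid $G$. $K$ (complement map) is the homothety with center $G$ and ratio $-1/2$; $K^{-1}(ABC)$ is the anticomplementary triangle. $\iota$ is the isotomic map $(x,y,z)\mapsto(1/x,1/y,1/z)$ in homogeneous barycentric coordinates, and $P'=\iota(P)$. $T_P$ is the unique affine map taking $A,B,C$ to the traces $D=AP\cap BC$, $E=BP\cap CA$, $F=CP\cap AB$ of $P$, respectively, and $T_{P'}$ is the unique affine map taking $A,B,C$ to the corresponding traces of $P'$. *)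

theory Defs
  imports "HOL-Analysis.Analysis"
begin

section \<open>The extended Euclidean plane\<close>

text \<open>A point at infinity is a parallel class of lines, represented by the common
  one-dimensional space of direction vectors.\<close>

typedef direction = "{S :: (real^2) set. subspace S \<and> dim S = 1}"
proof
  show "span {axis 1 1 :: real^2} \<in> {S. subspace S \<and> dim S = 1}"
    by (simp add: dim_singleton axis_eq_0_iff)
qed

text \<open>\<open>dir_of v\<close> is meaningful only for \<open>v \<noteq> 0\<close>.\<close>

definition dir_of :: "real^2 \<Rightarrow> direction" where
  "dir_of v = Abs_direction (span {v})"

datatype epoint = Ordinary "real^2" | Ideal direction

definition proper_line :: "real^2 \<Rightarrow> direction \<Rightarrow> epoint set" where
  "proper_line a d = insert (Ideal d) (Ordinary ` {a + v | v. v \<in> Rep_direction d})"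

definition line_at_infinity :: "epoint set" where
  "line_at_infinity = range Ideal"

definition ext_lines :: "epoint set set" where
  "ext_lines = insert line_at_infinity {proper_line a d | a d. True}"

text \<open>\<open>join\<close> presupposes distinct points, \<open>meet\<close> distinct extended lines.\<close>

definition join :: "epoint \<Rightarrow> epoint \<Rightarrow> epoint set" where
  "join P Q = (THE l. l \<in> ext_lines \<and> P \<in> l \<and> Q \<in> l)"

definition meet :: "epoint set \<Rightarrow> epoint set \<Rightarrow> epoint" where
  "meet l m = (THE X. X \<in> l \<and> X \<in> m)"

definition extended_sides :: "real^2 \<Rightarrow> real^2 \<Rightarrow> real^2 \<Rightarrow> epoint set" where
  "extended_sides A B C =
     join (Ordinary B) (Ordinary C) \<union> join (Ordinary C) (Ordinary A) \<union> join (Ordinary A) (Ordinary B)"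

section \<open>Barycentric coordinates and the isotomic map\<close>

text \<open>Homogeneous coordinates of sum 0 describe the points at infinity; then
  \<open>x A + y B + z C\<close> is a vector independent of the choice of origin.\<close>

definition barycentric ::
    "real^2 \<Rightarrow> real^2 \<Rightarrow> real^2 \<Rightarrow> epoint \<Rightarrow> real \<Rightarrow> real \<Rightarrow> real \<Rightarrow> bool" where
  "barycentric A B C P x y z \<longleftrightarrow>
     (x, y, z) \<noteq> (0, 0, 0) \<and>
     P = (if x + y + z \<noteq> 0
          then Ordinary ((1 / (x + y + z)) *\<^sub>R (x *\<^sub>R A + y *\<^sub>R B + z *\<^sub>R C))
          else Ideal (dir_of (x *\<^sub>R A + y *\<^sub>R B + z *\<^sub>R C)))"

text \<open>Meaningful for points off the extended sides of \<open>ABC\<close>, where all three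
  coordinates are nonzero.\<close>

definition isotomic :: "real^2 \<Rightarrow> real^2 \<Rightarrow> real^2 \<Rightarrow> epoint \<Rightarrow> epoint" where
  "isotomic A B C P =
     (THE P'. \<exists>x y z. barycentric A B C P x y z \<and> barycentric A B C P' (1 / x) (1 / y) (1 / z))"

definition Q_sqrt2 :: "real set" where
  "Q_sqrt2 = {a + b * sqrt 2 | a b. a \<in> \<rat> \<and> b \<in> \<rat>}"

section \<open>Affine maps\<close>

definition affine_map :: "(real^2 \<Rightarrow> real^2) \<Rightarrow> bool" where
  "affine_map T \<longleftrightarrow> (\<exists>f b. linear f \<and> T = (\<lambda>X. f X + b))"

definition translation :: "(real^2 \<Rightarrow> real^2) \<Rightarrow> bool" where
  "translation T \<longleftrightarrow> (\<exists>v. T = (\<lambda>X. X + v))"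

definition homothety :: "real^2 \<Rightarrow> real \<Rightarrow> real^2 \<Rightarrow> real^2" where
  "homothety Z r X = Z + r *\<^sub>R (X - Z)"

definition centroid :: "real^2 \<Rightarrow> real^2 \<Rightarrow> real^2 \<Rightarrow> real^2" where
  "centroid A B C = (1 / 3) *\<^sub>R (A + B + C)"

definition complement_map :: "real^2 \<Rightarrow> real^2 \<Rightarrow> real^2 \<Rightarrow> real^2 \<Rightarrow> real^2" where
  "complement_map A B C = homothety (centroid A B C) (- (1 / 2))"

text \<open>The trace of \<open>P\<close> on \<open>BC\<close> is \<open>trace_on A B C P\<close>.\<close>

definition trace_on :: "real^2 \<Rightarrow> real^2 \<Rightarrow> real^2 \<Rightarrow> epoint \<Rightarrow> epoint" where
  "trace_on A B C P = meet (join (Ordinary A) P) (join (Ordinary B) (Ordinary C))"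

text \<open>All three traces are ordinary when \<open>P\<close> is on no extended side of \<open>ABC\<close> or of its
  anticomplementary triangle; \<open>P\<close> itself may be at infinity.\<close>

definition T_map :: "real^2 \<Rightarrow> real^2 \<Rightarrow> real^2 \<Rightarrow> epoint \<Rightarrow> real^2 \<Rightarrow> real^2" where
  "T_map A B C P = (THE T. affine_map T \<and>
     Ordinary (T A) = trace_on A B C P \<and>
     Ordinary (T B) = trace_on B C A P \<and>
     Ordinary (T C) = trace_on C A B P)"

definition M_map :: "real^2 \<Rightarrow> real^2 \<Rightarrow> real^2 \<Rightarrow> epoint \<Rightarrow> real^2 \<Rightarrow> real^2" where
  "M_map A B C P =
     T_map A B C P \<circ> inv (complement_map A B C) \<circ> T_map A B C (isotomic A B C P)"

end

theory Submission
  imports Defs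
begin

text \<open>
Write \<open>P = (x : y : z)\<close> and put \<open>p = (y - z)/(y + z)\<close>, \<open>q = (z - x)/(z + x)\<close>, \<open>r = (x - y)/(x + y)\<close>;
these three numbers say where the traces of \<open>P\<close> divide the sides, and passing to the isotomic
point changes all their signs. Evaluating \<open>M\<close> at the vertices gives
\<open>M(A) = D + p(E - F)\<close>, \<open>M(B) = E + q(F - D)\<close>, \<open>M(C) = F + r(D - E)\<close>, and comparing the
displacements of the vertices shows that \<open>M\<close> is a translation as soon as
\<open>pq + qr + rp = -3\<close> (\<open>translation_M_map\<close>).

Since \<open>p + q + r + pqr = 0\<close> (Ceva), \<open>r = -(p + q)/(1 + pq)\<close> can be eliminated. What remains is
the quadratic \<open>p\<^sup>2(q\<^sup>2 - 1) + 2qp + 3 - q\<^sup>2 = 0\<close> in \<open>p\<close>, a curve of genus one, which is solvable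
over a field containing \<open>q\<close> exactly when \<open>q\<^sup>4 - 3q\<^sup>2 + 3\<close> is a square there (\<open>q\<^sup>2 \<noteq> 1\<close>).
Looking for \<open>q\<close> of the form \<open>s\<surd>2\<close> with \<open>s\<close> rational turns this into the quartic
\<open>w\<^sup>2 = 4s\<^sup>4 - 6s\<^sup>2 + 3\<close> over the rationals. It has the rational point \<open>(1, 1)\<close>, and a
doubling map on it doubles the even part of the denominator of \<open>s\<close>, so the orbit
of one point is infinite (\<open>infinite_rational_points\<close>).

Each such \<open>(s, w)\<close> yields \<open>p\<close> and \<open>q\<close> in \<open>\<rat>(\<surd>2)\<close>, and the irrationality of \<open>\<surd>2\<close> excludes all
degenerate positions (\<open>curve_point\<close>): \<open>P\<close> lies on no forbidden line, and neither \<open>P\<close> nor its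
isotomic image lies at infinity. So only ordinary points have to be treated, although
joins and meets are taken in the extended plane.
\<close>

section \<open>Coordinates with respect to a triangle\<close>

definition cross2 :: "real^2 \<Rightarrow> real^2 \<Rightarrow> real" where
  "cross2 u v = u $ 1 * v $ 2 - u $ 2 * v $ 1"

lemma cross2_nonzero_if_not_collinear:
  assumes "\<not> collinear {A, B, C :: real^2}"
  shows "cross2 (B - A) (C - A) \<noteq> 0"
proof
  assume 0: "cross2 (B - A) (C - A) = 0"
  have "B \<noteq> A" using assms by auto
  then obtain i where i: "(B - A) $ i \<noteq> 0" by (auto simp: vec_eq_iff)
  have "(C - A) $ j * (B - A) $ i = (C - A) $ i * (B - A) $ j" for j
    using 0 exhaust_2[of i] exhaust_2[of j] by (auto simp: cross2_def mult.commute)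
  then have "C - A = ((C - A) $ i / (B - A) $ i) *\<^sub>R (B - A)"
    using i by (simp add: vec_eq_iff eq_divide_eq)
  then have "collinear {0, B - A, C - A}"
    unfolding collinear_lemma by blast
  then have "collinear {B, A, C}" by (subst collinear_3) auto
  then show False using assms by (simp add: insert_commute)
qed

lemma barycentric_coordinates_unique:
  assumes "cross2 (B - A) (C - A) \<noteq> 0"
    and "x + y + z = x' + y' + z'"
    and "x *\<^sub>R A + y *\<^sub>R B + z *\<^sub>R C = x' *\<^sub>R A + y' *\<^sub>R B + z' *\<^sub>R C"
  shows "x = x' \<and> y = y' \<and> z = z'"
proof -
  have x: "x - x' = - (y - y') - (z - z')" using assms(2) by simp
  have "(x - x') * A $ i + (y - y') * B $ i + (z - z') * C $ i = 0" for i
    using arg_cong[OF assms(3), of "\<lambda>v. v $ i"] by (simp add: algebra_simps)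
  then have e: "(y - y') * (B - A) $ i + (z - z') * (C - A) $ i = 0" for i
    unfolding x by (simp add: algebra_simps)
  have "(y - y') * cross2 (B - A) (C - A) = 0" "(z - z') * cross2 (B - A) (C - A) = 0"
    using e[of 1] e[of 2] unfolding cross2_def by algebra+
  with assms(1) x show ?thesis by simp
qed

lemma barycentric_coordinates_exist:
  assumes d: "cross2 (B - A) (C - A) \<noteq> 0"
  obtains x y z where "x + y + z = 1" "X = x *\<^sub>R A + y *\<^sub>R B + z *\<^sub>R C"
proof
  define y z where "y = cross2 (X - A) (C - A) / cross2 (B - A) (C - A)"
    and "z = cross2 (B - A) (X - A) / cross2 (B - A) (C - A)"
  then have yz: "cross2 (B - A) (C - A) * y = cross2 (X - A) (C - A)"
    "cross2 (B - A) (C - A) * z = cross2 (B - A) (X - A)"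
    using d by simp_all
  show "(1 - y - z) + y + z = 1" by simp
  have "cross2 (B - A) (C - A) * X $ i
      = cross2 (B - A) (C - A) * ((1 - y - z) * A $ i + y * B $ i + z * C $ i)" for i
  proof -
    have "cross2 (B - A) (C - A) * X $ i
        = (cross2 (B - A) (C - A) - cross2 (X - A) (C - A) - cross2 (B - A) (X - A)) * A $ i
        + cross2 (X - A) (C - A) * B $ i + cross2 (B - A) (X - A) * C $ i"
      using exhaust_2[of i] by (auto simp: cross2_def algebra_simps)
    then show ?thesis unfolding yz[symmetric] by algebra
  qed
  then show "X = (1 - y - z) *\<^sub>R A + y *\<^sub>R B + z *\<^sub>R C"
    using d by (simp add: vec_eq_iff)
qed

lemma cross2_rotate: "cross2 (C - B) (A - B) = cross2 (B - A) (C - A)"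
  by (simp add: cross2_def algebra_simps)

section \<open>Joins and meets in the extended plane\<close>

lemma Rep_dir_of: "v \<noteq> 0 \<Longrightarrow> Rep_direction (dir_of v) = span {v}"
  unfolding dir_of_def by (rule Abs_direction_inverse) (simp add: dim_span)

text \<open>A direction determines its line of vectors through any one of its nonzero vectors; this makes
  the extended line through two ordinary points unique.\<close>

lemma Rep_direction_eq_span:
  assumes "v \<in> Rep_direction d" "v \<noteq> 0"
  shows "Rep_direction d = span {v}"
proof -
  have "subspace (Rep_direction d)" "dim (Rep_direction d) = 1"
    using Rep_direction[of d] by auto
  then have "Rep_direction d \<subseteq> span {v}"
    using card_ge_dim_independent[of "{v}" "Rep_direction d"] assms by simp
  moreover have "span {v} \<subseteq> Rep_direction d"
    using assms \<open>subspace (Rep_direction d)\<close> by (simp add: span_minimal)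
  ultimately show ?thesis by blast
qed

lemma join_ordinary:
  assumes "P \<noteq> Q"
  shows "join (Ordinary P) (Ordinary Q) = proper_line P (dir_of (Q - P))"
  unfolding join_def
proof (rule the_equality)
  have R: "Rep_direction (dir_of (Q - P)) = span {Q - P}" using assms by (simp add: Rep_dir_of)
  have "Q = P + (Q - P)" "P = P + 0" by simp_all
  then have "Ordinary Q \<in> proper_line P (dir_of (Q - P))" "Ordinary P \<in> proper_line P (dir_of (Q - P))"
    unfolding proper_line_def R using span_base[of "Q - P" "{Q - P}"] span_zero[of "{Q - P}"]
    by blast+
  then show "proper_line P (dir_of (Q - P)) \<in> ext_lines \<and>
      Ordinary P \<in> proper_line P (dir_of (Q - P)) \<and> Ordinary Q \<in> proper_line P (dir_of (Q - P))"
    by (auto simp: ext_lines_def)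
next
  fix l assume l: "l \<in> ext_lines \<and> Ordinary P \<in> l \<and> Ordinary Q \<in> l"
  then obtain a d where ad: "l = proper_line a d"
    by (auto simp: ext_lines_def line_at_infinity_def)
  have sub: "subspace (Rep_direction d)" using Rep_direction[of d] by auto
  obtain v w where v: "P = a + v" "v \<in> Rep_direction d" and w: "Q = a + w" "w \<in> Rep_direction d"
    using l by (auto simp: ad proper_line_def)
  have QP: "Q - P = w - v" using v w by simp
  then have "Q - P \<in> Rep_direction d" using v w sub by (simp add: subspace_diff)
  then have S: "Rep_direction d = span {Q - P}" using assms by (intro Rep_direction_eq_span) auto
  then have d: "d = dir_of (Q - P)"
    unfolding dir_of_def by (metis Rep_direction_inverse)
  have "{a + u | u. u \<in> Rep_direction d} = {P + u | u. u \<in> Rep_direction d}"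
  proof (safe)
    fix u assume "u \<in> Rep_direction d"
    then show "\<exists>t. a + u = P + t \<and> t \<in> Rep_direction d"
      using v sub by (intro exI[of _ "u - v"]) (simp add: subspace_diff)
  next
    fix u assume "u \<in> Rep_direction d"
    then show "\<exists>t. P + u = a + t \<and> t \<in> Rep_direction d"
      using v sub by (intro exI[of _ "v + u"]) (simp add: subspace_add)
  qed
  then show "l = proper_line P (dir_of (Q - P))" unfolding ad proper_line_def d by simp
qed

lemma Ordinary_in_join_iff:
  assumes "P \<noteq> Q"
  shows "Ordinary X \<in> join (Ordinary P) (Ordinary Q) \<longleftrightarrow> (\<exists>k. X = P + k *\<^sub>R (Q - P))"
  using assms by (auto simp: join_ordinary proper_line_def Rep_dir_of span_singleton)

lemma Ideal_in_join_iff: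
  assumes "P \<noteq> Q"
  shows "Ideal d \<in> join (Ordinary P) (Ordinary Q) \<longleftrightarrow> d = dir_of (Q - P)"
  using assms by (auto simp: join_ordinary proper_line_def)

text \<open>The common point is unique in the extended plane because the lines are not parallel:
  a nonzero cross product rules out a second ordinary point as well as a common ideal point.\<close>

lemma meet_join_ordinary:
  assumes "cross2 (Q - P) (S - R) \<noteq> 0" and "X = P + k *\<^sub>R (Q - P)" and "X = R + h *\<^sub>R (S - R)"
  shows "meet (join (Ordinary P) (Ordinary Q)) (join (Ordinary R) (Ordinary S)) = Ordinary X"
proof -
  have ne: "P \<noteq> Q" "R \<noteq> S" using assms(1) by (auto simp: cross2_def)
  have *: "Y = Ordinary X" if Y: "Y \<in> join (Ordinary P) (Ordinary Q)" "Y \<in> join (Ordinary R) (Ordinary S)" for Y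
  proof (cases Y)
    case (Ordinary Z)
    obtain k' h' where Z: "Z = P + k' *\<^sub>R (Q - P)" "Z = R + h' *\<^sub>R (S - R)"
      using Y ne unfolding Ordinary by (metis Ordinary_in_join_iff)
    have par: "(k' - k) *\<^sub>R (Q - P) = (h' - h) *\<^sub>R (S - R)"
      using Z assms(2,3) by (metis (no_types, lifting) add_diff_cancel_left scaleR_left_diff_distrib)
    have e: "(k' - k) * (Q - P) $ i = (h' - h) * (S - R) $ i" for i
      using arg_cong[OF par, of "\<lambda>v. v $ i"] by simp
    have "(k' - k) * cross2 (Q - P) (S - R) = 0"
      using e[of 1] e[of 2] unfolding cross2_def by algebra
    then show ?thesis using assms Z Ordinary by simp
  next
    case (Ideal d)
    then have "dir_of (Q - P) = dir_of (S - R)" using Y ne by (auto simp: Ideal_in_join_iff)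
    then have "span {Q - P} = span {S - R}" using ne by (metis Rep_dir_of eq_iff_diff_eq_0)
    then obtain c where "Q - P = c *\<^sub>R (S - R)"
      using span_base[of "Q - P" "{Q - P}"] by (auto simp: span_singleton)
    then show ?thesis using assms(1) by (simp add: cross2_def)
  qed
  have "Ordinary X \<in> join (Ordinary P) (Ordinary Q)" "Ordinary X \<in> join (Ordinary R) (Ordinary S)"
    using ne assms(2,3) Ordinary_in_join_iff by blast+
  then show ?thesis unfolding meet_def using * by blast
qed

section \<open>Traces, trace maps and the isotomic point\<close>

definition bary_point :: "real^2 \<Rightarrow> real^2 \<Rightarrow> real^2 \<Rightarrow> real \<Rightarrow> real \<Rightarrow> real \<Rightarrow> real^2" where
  "bary_point A B C x y z = (1 / (x + y + z)) *\<^sub>R (x *\<^sub>R A + y *\<^sub>R B + z *\<^sub>R C)"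

text \<open>By this symmetry one computation, for the trace on \<open>BC\<close>, serves all three sides.\<close>

lemma bary_point_rotate: "bary_point B C A y z x = bary_point A B C x y z"
  by (simp add: bary_point_def add.commute add.left_commute)

lemma bary_point_normalized:
  assumes "x + y + z \<noteq> 0"
  obtains x' y' z' where "x' + y' + z' = 1" "bary_point A B C x y z = x' *\<^sub>R A + y' *\<^sub>R B + z' *\<^sub>R C"
    "x = (x + y + z) * x'" "y = (x + y + z) * y'" "z = (x + y + z) * z'"
proof
  let ?s = "x + y + z"
  show "x / ?s + y / ?s + z / ?s = 1" using assms by (simp add: add_divide_distrib[symmetric])
  show "bary_point A B C x y z = (x / ?s) *\<^sub>R A + (y / ?s) *\<^sub>R B + (z / ?s) *\<^sub>R C"
    by (simp add: bary_point_def scaleR_add_right)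
qed (use assms in simp_all)

lemma bary_point_eqD:
  assumes "cross2 (B - A) (C - A) \<noteq> 0" "x + y + z \<noteq> 0" "x' + y' + z' = 1"
    "bary_point A B C x y z = x' *\<^sub>R A + y' *\<^sub>R B + z' *\<^sub>R C"
  shows "x = (x + y + z) * x'" "y = (x + y + z) * y'" "z = (x + y + z) * z'"
proof -
  obtain a b c where "a + b + c = 1" "bary_point A B C x y z = a *\<^sub>R A + b *\<^sub>R B + c *\<^sub>R C"
    "x = (x + y + z) * a" "y = (x + y + z) * b" "z = (x + y + z) * c"
    using bary_point_normalized[OF assms(2)] by metis
  with assms barycentric_coordinates_unique[OF assms(1), of a b c x' y' z'] 
  show "x = (x + y + z) * x'" "y = (x + y + z) * y'" "z = (x + y + z) * z'" by simp_all
qed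

lemma barycentric_bary_point:
  assumes "x + y + z \<noteq> 0"
  shows "barycentric A B C P x y z \<longleftrightarrow> P = Ordinary (bary_point A B C x y z)"
  using assms by (auto simp: barycentric_def bary_point_def)

lemma bary_point_proportional:
  assumes "cross2 (B - A) (C - A) \<noteq> 0" "x + y + z \<noteq> 0" "x' + y' + z' \<noteq> 0"
    "bary_point A B C x y z = bary_point A B C x' y' z'"
  obtains c where "c \<noteq> 0" "x' = c * x" "y' = c * y" "z' = c * z"
proof -
  obtain a b c where *: "a + b + c = 1" "bary_point A B C x y z = a *\<^sub>R A + b *\<^sub>R B + c *\<^sub>R C"
    "x = (x + y + z) * a" "y = (x + y + z) * b" "z = (x + y + z) * c"
    using bary_point_normalized[OF assms(2)] by metis
  have **: "x' = (x' + y' + z') * a" "y' = (x' + y' + z') * b" "z' = (x' + y' + z') * c"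
    using bary_point_eqD[OF assms(1,3) *(1)] *(2) assms(4) by auto
  define s s' where "s = x + y + z" and "s' = x' + y' + z'"
  have "x' = s' / s * x" "y' = s' / s * y" "z' = s' / s * z" "s' / s \<noteq> 0"
    using *(3-5) ** assms(2,3) unfolding s_def[symmetric] s'_def[symmetric]
    by (metis mult.assoc nonzero_mult_div_cancel_left times_divide_eq_left mult.commute divide_eq_0_iff)+
  then show ?thesis using that by blast
qed

text \<open>The line \<open>AP\<close> has direction \<open>y(B - A) + z(C - A)\<close>, whose cross product with \<open>C - B\<close> is
  \<open>y + z\<close> times that of \<open>ABC\<close>; so \<open>y + z \<noteq> 0\<close> makes the trace ordinary, and then also
  \<open>P \<noteq> A\<close>.\<close>

lemma trace_on_bary_point:
  assumes d: "cross2 (B - A) (C - A) \<noteq> 0" and s: "x + y + z \<noteq> 0" and yz: "y + z \<noteq> 0"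
  shows "trace_on A B C (Ordinary (bary_point A B C x y z))
       = Ordinary ((y / (y + z)) *\<^sub>R B + (z / (y + z)) *\<^sub>R C)"
  unfolding trace_on_def
proof (rule meet_join_ordinary)
  let ?P = "bary_point A B C x y z" and ?s = "x + y + z"
  have P: "(?P - A) = (1 / ?s) *\<^sub>R (y *\<^sub>R (B - A) + z *\<^sub>R (C - A))"
  proof -
    have "y *\<^sub>R (B - A) + z *\<^sub>R (C - A) = (x *\<^sub>R A + y *\<^sub>R B + z *\<^sub>R C) - ?s *\<^sub>R A"
      by (simp add: algebra_simps)
    then show ?thesis using s by (simp only: bary_point_def scaleR_diff_right) simp
  qed
  have "cross2 (?P - A) (C - B) = (y + z) / ?s * cross2 (B - A) (C - A)"
  proof -
    have "cross2 (t *\<^sub>R v) w = t * cross2 v w" for t v w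
      by (simp add: cross2_def algebra_simps)
    moreover have "cross2 (y *\<^sub>R (B - A) + z *\<^sub>R (C - A)) (C - B) = (y + z) * cross2 (B - A) (C - A)"
      by (simp add: cross2_def algebra_simps)
    ultimately show ?thesis unfolding P by simp
  qed
  then show "cross2 (?P - A) (C - B) \<noteq> 0" using d s yz by simp
  show "(y / (y + z)) *\<^sub>R B + (z / (y + z)) *\<^sub>R C = A + (?s / (y + z)) *\<^sub>R (?P - A)"
  proof -
    have "(?s / (y + z)) *\<^sub>R (?P - A) = (1 / (y + z)) *\<^sub>R (y *\<^sub>R (B - A) + z *\<^sub>R (C - A))"
      unfolding P using s by simp
    moreover have "(y / (y + z)) *\<^sub>R B + (z / (y + z)) *\<^sub>R C
        = A + (1 / (y + z)) *\<^sub>R (y *\<^sub>R (B - A) + z *\<^sub>R (C - A))"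
    proof -
      have "y *\<^sub>R (B - A) + z *\<^sub>R (C - A) = (y *\<^sub>R B + z *\<^sub>R C) - (y + z) *\<^sub>R A"
        by (simp add: algebra_simps)
      then show ?thesis using yz by (simp only: scaleR_diff_right) (simp add: scaleR_add_right)
    qed
    ultimately show ?thesis by simp
  qed
  show "(y / (y + z)) *\<^sub>R B + (z / (y + z)) *\<^sub>R C = B + (z / (y + z)) *\<^sub>R (C - B)"
    using yz by (simp add: vec_eq_iff field_simps)
qed

lemma affine_map_combination:
  assumes "affine_map T" "x + y + z = 1"
  shows "T (x *\<^sub>R A + y *\<^sub>R B + z *\<^sub>R C) = x *\<^sub>R T A + y *\<^sub>R T B + z *\<^sub>R T C"
proof -
  obtain f b where f: "linear f" "T = (\<lambda>X. f X + b)" using assms(1) by (auto simp: affine_map_def)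
  have "b = (x + y + z) *\<^sub>R b" using assms(2) by simp
  then show ?thesis using f(1)
    by (simp add: f(2) linear_add linear_scale algebra_simps)
qed

lemma affine_map_exists:
  assumes d: "cross2 (B - A) (C - A) \<noteq> 0"
  shows "\<exists>T. affine_map T \<and> T A = D \<and> T B = E \<and> T C = F"
proof -
  let ?d = "cross2 (B - A) (C - A)"
  define f where "f X = (cross2 X (C - A) / ?d) *\<^sub>R (E - D) + (cross2 (B - A) X / ?d) *\<^sub>R (F - D)" for X
  have "linear f" 
    by (rule linearI) (auto simp: f_def cross2_def vec_eq_iff algebra_simps add_divide_distrib diff_divide_distrib)
  have z: "cross2 v v = 0" for v by (simp add: cross2_def)
  define T where "T X = f X + (D - f A)" for X
  have TX: "T X = D + f (X - A)" for X
    using \<open>linear f\<close> by (simp add: T_def linear_diff)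
  have "affine_map T" unfolding affine_map_def T_def using \<open>linear f\<close> by auto
  moreover have "T A = D" by (simp add: T_def)
  moreover have "T B = E" "T C = F" using d by (simp_all add: TX f_def z)
  ultimately show ?thesis by blast
qed

lemma T_map_bary_point:
  assumes d: "cross2 (B - A) (C - A) \<noteq> 0" and s: "x + y + z \<noteq> 0"
    and "y + z \<noteq> 0" "z + x \<noteq> 0" "x + y \<noteq> 0"
  defines "T \<equiv> T_map A B C (Ordinary (bary_point A B C x y z))"
  shows "affine_map T" 
    "T A = (y / (y + z)) *\<^sub>R B + (z / (y + z)) *\<^sub>R C"
    "T B = (z / (z + x)) *\<^sub>R C + (x / (z + x)) *\<^sub>R A"
    "T C = (x / (x + y)) *\<^sub>R A + (y / (x + y)) *\<^sub>R B"
proof -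
  let ?P = "Ordinary (bary_point A B C x y z)"
  let ?D = "(y / (y + z)) *\<^sub>R B + (z / (y + z)) *\<^sub>R C"
  let ?E = "(z / (z + x)) *\<^sub>R C + (x / (z + x)) *\<^sub>R A"
  let ?F = "(x / (x + y)) *\<^sub>R A + (y / (x + y)) *\<^sub>R B"
  have d2: "cross2 (C - B) (A - B) \<noteq> 0" "cross2 (A - C) (B - C) \<noteq> 0"
    using d cross2_rotate by metis+
  have tr: "trace_on A B C ?P = Ordinary ?D" "trace_on B C A ?P = Ordinary ?E" "trace_on C A B ?P = Ordinary ?F"
    using trace_on_bary_point[OF d s] trace_on_bary_point[OF d2(1), of y z x] trace_on_bary_point[OF d2(2), of z x y] assms(2-5)
    by (simp_all add: bary_point_rotate add.commute add.left_commute)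
  have "\<exists>!T. affine_map T \<and> T A = ?D \<and> T B = ?E \<and> T C = ?F"
  proof (rule ex_ex1I[OF affine_map_exists[OF d]], rule ext)
    fix T U X
    assume *: "affine_map T \<and> T A = ?D \<and> T B = ?E \<and> T C = ?F" "affine_map U \<and> U A = ?D \<and> U B = ?E \<and> U C = ?F"
    obtain a b c where "a + b + c = 1" "X = a *\<^sub>R A + b *\<^sub>R B + c *\<^sub>R C"
      using barycentric_coordinates_exist[OF d] by metis
    with * show "T X = U X" by (simp add: affine_map_combination)
  qed
  from theI'[OF this] show "affine_map T" "T A = ?D" "T B = ?E" "T C = ?F"
    unfolding T_def T_map_def tr epoint.inject by blast+
qed

text \<open>The description defining the isotomic point ranges over all coordinate triples of \<open>P\<close>.
  They are proportional, hence so are their reciprocals, which therefore describe one point.\<close>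

lemma isotomic_bary_point:
  assumes d: "cross2 (B - A) (C - A) \<noteq> 0" and s: "x + y + z \<noteq> 0"
    and nz: "x \<noteq> 0" "y \<noteq> 0" "z \<noteq> 0" and s': "1 / x + 1 / y + 1 / z \<noteq> 0"
  shows "isotomic A B C (Ordinary (bary_point A B C x y z)) = Ordinary (bary_point A B C (1 / x) (1 / y) (1 / z))"
  unfolding isotomic_def
proof (rule the_equality)
  show "\<exists>x' y' z'. barycentric A B C (Ordinary (bary_point A B C x y z)) x' y' z' \<and>
      barycentric A B C (Ordinary (bary_point A B C (1 / x) (1 / y) (1 / z))) (1 / x') (1 / y') (1 / z')"
    using s s' barycentric_bary_point by blast
next
  fix Q assume "\<exists>x' y' z'. barycentric A B C (Ordinary (bary_point A B C x y z)) x' y' z' \<and>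
      barycentric A B C Q (1 / x') (1 / y') (1 / z')"
  then obtain x' y' z' where *: "barycentric A B C (Ordinary (bary_point A B C x y z)) x' y' z'"
      "barycentric A B C Q (1 / x') (1 / y') (1 / z')" by blast
  have sn: "x' + y' + z' \<noteq> 0" using *(1) by (auto simp: barycentric_def)
  then have "bary_point A B C x y z = bary_point A B C x' y' z'"
    using *(1) by (simp add: barycentric_bary_point)
  then obtain c where c: "c \<noteq> 0" "x' = c * x" "y' = c * y" "z' = c * z"
    using bary_point_proportional[OF d s sn] by metis
  have sum: "1 / x' + 1 / y' + 1 / z' = (1 / c) * (1 / x + 1 / y + 1 / z)"
    unfolding c(2-4) using c(1) nz by (simp add: field_simps)
  with c(1) s' have "1 / x' + 1 / y' + 1 / z' \<noteq> 0" by simp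
  then have "Q = Ordinary (bary_point A B C (1 / x') (1 / y') (1 / z'))"
    using *(2) barycentric_bary_point by blast
  also have "bary_point A B C (1 / x') (1 / y') (1 / z') = bary_point A B C (1 / x) (1 / y) (1 / z)"
  proof -
    have "(1 / x') *\<^sub>R A + (1 / y') *\<^sub>R B + (1 / z') *\<^sub>R C
        = (1 / c) *\<^sub>R ((1 / x) *\<^sub>R A + (1 / y) *\<^sub>R B + (1 / z) *\<^sub>R C)"
      unfolding c(2-4) by (simp add: scaleR_add_right)
    then show ?thesis unfolding bary_point_def sum using c(1) by simp
  qed
  finally show "Q = Ordinary (bary_point A B C (1 / x) (1 / y) (1 / z))" .
qed

lemma inv_complement_map: "inv (complement_map A B C) X = A + B + C - 2 *\<^sub>R X"
proof -
  have K: "complement_map A B C Y = (1 / 2) *\<^sub>R (A + B + C - Y)" for Y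
    by (simp add: complement_map_def homothety_def centroid_def vec_eq_iff field_simps)
  show ?thesis
  proof (rule inv_f_eq)
    show "inj (complement_map A B C)" by (rule injI) (simp add: K)
    show "complement_map A B C (A + B + C - 2 *\<^sub>R X) = X" by (simp add: K)
  qed
qed

section \<open>A criterion for \<open>M\<close> to be a translation\<close>

text \<open>The inverse complement map sends \<open>D' = T\<^bsub>P'\<^esub>(A)\<close> to the point with coordinates \<open>(1, p, -p)\<close>, and
  cyclically, which gives \<open>M(A) = D + p(E - F)\<close> and its analogues. The displacements
  of two vertices then differ by \<open>(pq + qr + rp + 3)/2\<close> times the side joining them, and an affine
  map that displaces three independent points equally is a translation.\<close>

lemma translation_M_map:
  assumes d: "cross2 (B - A) (C - A) \<noteq> 0" and s: "x + y + z \<noteq> 0"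
    and nz: "x \<noteq> 0" "y \<noteq> 0" "z \<noteq> 0" and s': "x * y + y * z + z * x \<noteq> 0"
    and sums: "y + z \<noteq> 0" "z + x \<noteq> 0" "x + y \<noteq> 0"
    and p: "p = (y - z) / (y + z)" and q: "q = (z - x) / (z + x)" and r: "r = (x - y) / (x + y)"
    and curve: "p * q + q * r + r * p = -3"
  shows "translation (M_map A B C (Ordinary (bary_point A B C x y z)))"
proof -
  let ?P = "Ordinary (bary_point A B C x y z)"
  let ?M = "M_map A B C ?P"
  let ?T = "T_map A B C ?P"
  let ?P' = "Ordinary (bary_point A B C (1 / x) (1 / y) (1 / z))"
  let ?T' = "T_map A B C ?P'"
  have s1: "1 / x + 1 / y + 1 / z \<noteq> 0" using s' nz by (simp add: field_simps)
  have sums': "1 / y + 1 / z \<noteq> 0" "1 / z + 1 / x \<noteq> 0" "1 / x + 1 / y \<noteq> 0"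
    using nz sums by (simp_all add: field_simps)
  have M: "?M X = ?T (A + B + C - 2 *\<^sub>R ?T' X)" for X
    by (simp add: M_map_def isotomic_bary_point[OF d s nz s1] inv_complement_map)
  have w: "y / (y + z) = (1 + p) / 2" "z / (y + z) = (1 - p) / 2"
    "z / (z + x) = (1 + q) / 2" "x / (z + x) = (1 - q) / 2"
    "x / (x + y) = (1 + r) / 2" "y / (x + y) = (1 - r) / 2"
    using sums by (simp_all add: p q r field_simps)
  have w': "(1 / y) / (1 / y + 1 / z) = (1 - p) / 2" "(1 / z) / (1 / y + 1 / z) = (1 + p) / 2"
    "(1 / z) / (1 / z + 1 / x) = (1 - q) / 2" "(1 / x) / (1 / z + 1 / x) = (1 + q) / 2"
    "(1 / x) / (1 / x + 1 / y) = (1 - r) / 2" "(1 / y) / (1 / x + 1 / y) = (1 + r) / 2"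
    using sums nz unfolding w(1-6)[symmetric] by (simp_all add: field_simps)
  note T = T_map_bary_point[OF d s sums, unfolded w]
  note T' = T_map_bary_point[OF d s1 sums', unfolded w']
  have K: "A + B + C - 2 *\<^sub>R ?T' A = 1 *\<^sub>R A + p *\<^sub>R B + (- p) *\<^sub>R C"
    "A + B + C - 2 *\<^sub>R ?T' B = (- q) *\<^sub>R A + 1 *\<^sub>R B + q *\<^sub>R C"
    "A + B + C - 2 *\<^sub>R ?T' C = r *\<^sub>R A + (- r) *\<^sub>R B + 1 *\<^sub>R C"
    unfolding T'(2-4) by (simp_all add: vec_eq_iff field_simps)
  have MV: "?M A = 1 *\<^sub>R ?T A + p *\<^sub>R ?T B + (- p) *\<^sub>R ?T C"
    "?M B = (- q) *\<^sub>R ?T A + 1 *\<^sub>R ?T B + q *\<^sub>R ?T C"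
    "?M C = r *\<^sub>R ?T A + (- r) *\<^sub>R ?T B + 1 *\<^sub>R ?T C"
    unfolding M K by (rule affine_map_combination[OF T(1)], simp)+
  have "(?M B - B) $ i = (?M A - A) $ i \<and> (?M C - C) $ i = (?M A - A) $ i" for i
  proof -
    define a b c where abc: "a = A $ i" "b = B $ i" "c = C $ i"
    have co: "(?M A - A) $ i = ((1 + p) * b + (1 - p) * c + p * ((1 + q) * c + (1 - q) * a)
          - p * ((1 + r) * a + (1 - r) * b)) / 2 - a"
      "(?M B - B) $ i = ((1 + q) * c + (1 - q) * a + q * ((1 + r) * a + (1 - r) * b)
          - q * ((1 + p) * b + (1 - p) * c)) / 2 - b"
      "(?M C - C) $ i = ((1 + r) * a + (1 - r) * b + r * ((1 + p) * b + (1 - p) * c)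
          - r * ((1 + q) * c + (1 - q) * a)) / 2 - c"
      unfolding MV T(2-4) abc by (simp_all add: field_simps)
    have "(?M B - B) $ i - (?M A - A) $ i = (p * q + q * r + r * p + 3) * (a - b) / 2"
      "(?M C - C) $ i - (?M A - A) $ i = (p * q + q * r + r * p + 3) * (a - c) / 2"
      unfolding co by (simp_all add: field_simps)
    then show ?thesis using curve by simp
  qed
  then have MB: "?M B - B = ?M A - A" and MC: "?M C - C = ?M A - A"
    unfolding vec_eq_iff by blast+
  have "?M X = X + (?M A - A)" for X
  proof -
    obtain a b c where abc: "a + b + c = 1" and X: "X = a *\<^sub>R A + b *\<^sub>R B + c *\<^sub>R C"
      using barycentric_coordinates_exist[OF d] by metis
    have "A + B + C - 2 *\<^sub>R ?T' X = a *\<^sub>R (A + B + C - 2 *\<^sub>R ?T' A)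
        + b *\<^sub>R (A + B + C - 2 *\<^sub>R ?T' B) + c *\<^sub>R (A + B + C - 2 *\<^sub>R ?T' C)"
    proof -
      define S where "S = A + B + C"
      have "S = (a + b + c) *\<^sub>R S" using abc by simp
      then have "S = a *\<^sub>R S + b *\<^sub>R S + c *\<^sub>R S" by (simp only: scaleR_left_distrib)
      then show ?thesis unfolding X affine_map_combination[OF T'(1) abc] S_def[symmetric]
        by (simp add: scaleR_right_distrib scaleR_right_diff_distrib mult.commute add.assoc)
    qed
    then have "?M X = a *\<^sub>R ?M A + b *\<^sub>R ?M B + c *\<^sub>R ?M C"
      unfolding M by (simp add: affine_map_combination[OF T(1) abc])
    also have "\<dots> = X + (a + b + c) *\<^sub>R (?M A - A)"
    proof -
      define V where "V = ?M A - A"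
      have "?M A = V + A" "?M B = V + B" "?M C = V + C"
        using MB MC by (simp_all only: V_def diff_eq_eq diff_add_cancel)
      then show ?thesis unfolding V_def[symmetric] by (simp add: X algebra_simps)
    qed
    finally show ?thesis using abc by simp
  qed
  then show ?thesis unfolding translation_def by blast
qed

section \<open>Avoiding the side lines\<close>

text \<open>The line \<open>UV\<close> is given by a linear equation \<open>lx + my + nz = 0\<close> in barycentric coordinates.\<close>

lemma not_on_join:
  assumes d: "cross2 (B - A) (C - A) \<noteq> 0" and s: "x + y + z \<noteq> 0"
    and U: "U = u1 *\<^sub>R A + u2 *\<^sub>R B + u3 *\<^sub>R C" "u1 + u2 + u3 = 1"
    and V: "V = v1 *\<^sub>R A + v2 *\<^sub>R B + v3 *\<^sub>R C" "v1 + v2 + v3 = 1"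
    and UV: "U \<noteq> V"
    and zero: "l * u1 + m * u2 + n * u3 = 0" "l * v1 + m * v2 + n * v3 = 0"
    and nz: "l * x + m * y + n * z \<noteq> 0"
  shows "Ordinary (bary_point A B C x y z) \<notin> join (Ordinary U) (Ordinary V)"
proof
  assume "Ordinary (bary_point A B C x y z) \<in> join (Ordinary U) (Ordinary V)"
  then obtain k where k: "bary_point A B C x y z = U + k *\<^sub>R (V - U)"
    using UV by (auto simp: Ordinary_in_join_iff)
  have "bary_point A B C x y z = (u1 + k * (v1 - u1)) *\<^sub>R A + (u2 + k * (v2 - u2)) *\<^sub>R B
      + (u3 + k * (v3 - u3)) *\<^sub>R C"
    unfolding k U(1) V(1) by (simp add: algebra_simps)
  moreover have "(u1 + k * (v1 - u1)) + (u2 + k * (v2 - u2)) + (u3 + k * (v3 - u3)) = 1"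
    using U(2) V(2) by algebra
  ultimately have *: "x = (x + y + z) * (u1 + k * (v1 - u1))" "y = (x + y + z) * (u2 + k * (v2 - u2))"
    "z = (x + y + z) * (u3 + k * (v3 - u3))"
    using bary_point_eqD[OF d s] by metis+
  have "l * x + m * y + n * z = 0"
    using * zero by algebra
  with nz show False by simp
qed

lemma not_on_extended_sides:
  assumes d: "cross2 (B - A) (C - A) \<noteq> 0" and s: "x + y + z \<noteq> 0"
    and nz: "x \<noteq> 0" "y \<noteq> 0" "z \<noteq> 0"
  shows "Ordinary (bary_point A B C x y z) \<notin> extended_sides A B C"
proof -
  have ne: "A \<noteq> B" "B \<noteq> C" "C \<noteq> A" using d by (auto simp: cross2_def)
  have "Ordinary (bary_point A B C x y z) \<notin> join (Ordinary B) (Ordinary C)"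
    by (rule not_on_join[OF d s, of _ 0 1 0 _ 0 0 1 1 0 0]) (use ne nz in simp_all)
  moreover have "Ordinary (bary_point A B C x y z) \<notin> join (Ordinary C) (Ordinary A)"
    by (rule not_on_join[OF d s, of _ 0 0 1 _ 1 0 0 0 1 0]) (use ne nz in simp_all)
  moreover have "Ordinary (bary_point A B C x y z) \<notin> join (Ordinary A) (Ordinary B)"
    by (rule not_on_join[OF d s, of _ 1 0 0 _ 0 1 0 0 0 1]) (use ne nz in simp_all)
  ultimately show ?thesis by (simp add: extended_sides_def)
qed

text \<open>The anticomplementary vertices are \<open>(-1, 1, 1)\<close>, \<open>(1, -1, 1)\<close>, \<open>(1, 1, -1)\<close>, so its side lines
  are \<open>y + z = 0\<close>, \<open>z + x = 0\<close> and \<open>x + y = 0\<close>.\<close>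

lemma not_on_anticomplementary_sides:
  assumes d: "cross2 (B - A) (C - A) \<noteq> 0" and s: "x + y + z \<noteq> 0"
    and nz: "y + z \<noteq> 0" "z + x \<noteq> 0" "x + y \<noteq> 0"
  shows "Ordinary (bary_point A B C x y z) \<notin> extended_sides (inv (complement_map A B C) A)
                 (inv (complement_map A B C) B) (inv (complement_map A B C) C)"
proof -
  let ?U = "A + B + C - 2 *\<^sub>R A" and ?V = "A + B + C - 2 *\<^sub>R B" and ?W = "A + B + C - 2 *\<^sub>R C"
  have ne: "?U \<noteq> ?V" "?V \<noteq> ?W" "?W \<noteq> ?U" using d by (auto simp: cross2_def)
  have c: "?U = (-1) *\<^sub>R A + 1 *\<^sub>R B + 1 *\<^sub>R C" "?V = 1 *\<^sub>R A + (-1) *\<^sub>R B + 1 *\<^sub>R C"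
    "?W = 1 *\<^sub>R A + 1 *\<^sub>R B + (-1) *\<^sub>R C" by (simp_all add: vec_eq_iff)
  have "Ordinary (bary_point A B C x y z) \<notin> join (Ordinary ?V) (Ordinary ?W)"
    by (rule not_on_join[OF d s c(2) _ c(3) _ ne(2), of 0 1 1]) (use nz in simp_all)
  moreover have "Ordinary (bary_point A B C x y z) \<notin> join (Ordinary ?W) (Ordinary ?U)"
    by (rule not_on_join[OF d s c(3) _ c(1) _ ne(3), of 1 0 1]) (use nz in \<open>simp_all add: add.commute\<close>)
  moreover have "Ordinary (bary_point A B C x y z) \<notin> join (Ordinary ?U) (Ordinary ?V)"
    by (rule not_on_join[OF d s c(1) _ c(2) _ ne(1), of 1 1 0]) (use nz in simp_all)
  ultimately show ?thesis by (simp add: extended_sides_def inv_complement_map)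
qed

section \<open>Points over the quadratic field\<close>

lemma Q_sqrt2_I: "a \<in> \<rat> \<Longrightarrow> b \<in> \<rat> \<Longrightarrow> a + b * sqrt 2 \<in> Q_sqrt2"
  unfolding Q_sqrt2_def by blast

lemma Q_sqrt2_Rats: "a \<in> \<rat> \<Longrightarrow> a \<in> Q_sqrt2"
  using Q_sqrt2_I[of a 0] by simp

lemma Q_sqrt2_mult_sqrt2: "a \<in> \<rat> \<Longrightarrow> a * sqrt 2 \<in> Q_sqrt2"
  using Q_sqrt2_I[of 0 a] by simp

lemma Q_sqrt2_add: "u \<in> Q_sqrt2 \<Longrightarrow> v \<in> Q_sqrt2 \<Longrightarrow> u + v \<in> Q_sqrt2"
  unfolding Q_sqrt2_def
proof safe
  fix a b c d :: real assume "a \<in> \<rat>" "b \<in> \<rat>" "c \<in> \<rat>" "d \<in> \<rat>"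
  then show "\<exists>a' b'. a + b * sqrt 2 + (c + d * sqrt 2) = a' + b' * sqrt 2 \<and> a' \<in> \<rat> \<and> b' \<in> \<rat>"
    by (intro exI[of _ "a + c"] exI[of _ "b + d"]) (simp add: algebra_simps)
qed

lemma Q_sqrt2_mult: "u \<in> Q_sqrt2 \<Longrightarrow> v \<in> Q_sqrt2 \<Longrightarrow> u * v \<in> Q_sqrt2"
  unfolding Q_sqrt2_def
proof safe
  fix a b c d :: real assume "a \<in> \<rat>" "b \<in> \<rat>" "c \<in> \<rat>" "d \<in> \<rat>"
  then show "\<exists>a' b'. (a + b * sqrt 2) * (c + d * sqrt 2) = a' + b' * sqrt 2 \<and> a' \<in> \<rat> \<and> b' \<in> \<rat>"
    by (intro exI[of _ "a * c + 2 * b * d"] exI[of _ "a * d + b * c"]) (simp add: algebra_simps)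
qed

lemma Q_sqrt2_diff: "u \<in> Q_sqrt2 \<Longrightarrow> v \<in> Q_sqrt2 \<Longrightarrow> u - v \<in> Q_sqrt2"
  using Q_sqrt2_add[of u "(-1) * v"] Q_sqrt2_mult[of "-1" v] Q_sqrt2_Rats[of "-1"] by simp

lemma sqrt2_irrational: "sqrt 2 \<notin> \<rat>"
proof
  assume "sqrt 2 \<in> \<rat>"
  then obtain m n :: nat where n: "n \<noteq> 0" "\<bar>sqrt 2\<bar> = m / n" "coprime m n"
    by (rule Rats_abs_nat_div_natE)
  then have "(sqrt 2 * n)\<^sup>2 = (real m)\<^sup>2" by simp
  then have "real (2 * n\<^sup>2) = real (m\<^sup>2)" by (simp add: power_mult_distrib)
  then have eq: "2 * n\<^sup>2 = m\<^sup>2" by (rule of_nat_eq_iff[THEN iffD1])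
  then have "even (m\<^sup>2)" by (metis dvd_triv_left)
  then have "even m" by simp
  then obtain k where "m = 2 * k" by blast
  with eq have "n\<^sup>2 = 2 * k\<^sup>2" by (simp add: power_mult_distrib)
  then have "even (n\<^sup>2)" by simp
  then have "even n" by simp
  with \<open>even m\<close> n(3) show False by (auto dest: coprime_common_divisor_nat[of m n 2])
qed

lemma rational_combination_sqrt2_eq_0:
  assumes "a \<in> \<rat>" "b \<in> \<rat>" "a + b * sqrt 2 = 0"
  shows "a = 0" "b = 0"
proof -
  show "b = 0"
  proof (rule ccontr)
    assume "b \<noteq> 0"
    then have "sqrt 2 = - a / b" using assms(3) by (simp add: field_simps)
    then have "sqrt 2 \<in> \<rat>" using assms by simp
    then show False using sqrt2_irrational by simp
  qed
  then show "a = 0" using assms(3) by simp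
qed

text \<open>Here \<open>p\<close> is a root of the quadratic, by the quadratic formula. The last two inequations will say
  that \<open>P\<close> and \<open>P'\<close> are ordinary. For them, multiply by \<open>q\<^sup>2 - 1\<close> and use \<open>p(q\<^sup>2 - 1) = w - q\<close>: since
  \<open>q\<^sup>2\<close> and \<open>w\<close> are rational, the vanishing of the left side would be a relation \<open>a + b q = 0\<close> with
  rational \<open>a\<close>, \<open>b\<close>, and both of these would have to vanish, leaving \<open>3(q\<^sup>2 - 1) = 0\<close>.\<close>

lemma curve_point:
  fixes s w :: real
  assumes rat: "s \<in> \<rat>" "w \<in> \<rat>" and "s \<noteq> 0" and w: "w\<^sup>2 = 4 * s ^ 4 - 6 * s\<^sup>2 + 3"
  defines "q \<equiv> s * sqrt 2"
  defines "p \<equiv> (w - q) / (q\<^sup>2 - 1)"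
  shows "p \<in> Q_sqrt2" "p\<^sup>2 * (q\<^sup>2 - 1) + 2 * q * p + 3 - q\<^sup>2 = 0"
    "q\<^sup>2 \<noteq> 1" "p\<^sup>2 \<noteq> 1" "1 + p * q \<noteq> 0" "3 + q - p + p * q \<noteq> 0" "3 + p - q + p * q \<noteq> 0"
proof -
  have q2: "q\<^sup>2 = 2 * s\<^sup>2" by (simp add: q_def power_mult_distrib)
  have q2rat: "q\<^sup>2 \<in> \<rat>" using rat by (simp add: q2)
  have irr: "a = 0 \<and> b = 0" if "a \<in> \<rat>" "b \<in> \<rat>" "a + b * q = 0" for a b
    using rational_combination_sqrt2_eq_0[of a "b * s"] that rat \<open>s \<noteq> 0\<close> by (simp add: q_def mult.assoc)
  show q1: "q\<^sup>2 \<noteq> 1"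
  proof
    assume "q\<^sup>2 = 1"
    then have "q = 1 \<or> q = -1" by (simp add: power2_eq_1_iff)
    then show False using irr[of 1 1] irr[of 1 "-1"] by auto
  qed
  have pk: "p * (q\<^sup>2 - 1) = w - q" using q1 by (simp add: p_def)
  have "w\<^sup>2 = (q\<^sup>2)\<^sup>2 - 3 * q\<^sup>2 + 3" unfolding w q2 by (simp add: power_mult_distrib)
  then have "(q\<^sup>2 - 1) * (p\<^sup>2 * (q\<^sup>2 - 1) + 2 * q * p + 3 - q\<^sup>2) = 0"
    using pk by algebra
  then show eq: "p\<^sup>2 * (q\<^sup>2 - 1) + 2 * q * p + 3 - q\<^sup>2 = 0" using q1 by simp
  show p1: "p\<^sup>2 \<noteq> 1"
  proof
    assume "p\<^sup>2 = 1"
    then have "q\<^sup>2 = 1" using eq by algebra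
    then show False using q1 by simp
  qed
  show "1 + p * q \<noteq> 0"
  proof
    assume "1 + p * q = 0"
    then have "(p\<^sup>2 - 1) * (q\<^sup>2 - 1) = 0" using eq by algebra
    then show False using p1 q1 by simp
  qed
  show "3 + q - p + p * q \<noteq> 0"
  proof
    assume "3 + q - p + p * q = 0"
    then have "(3 * (q\<^sup>2 - 1) - w - q\<^sup>2) + (q\<^sup>2 + w) * q = 0" using pk by algebra
    then have "3 * (q\<^sup>2 - 1) - w - q\<^sup>2 = 0 \<and> q\<^sup>2 + w = 0" using rat q2rat by (intro irr) simp_all
    then show False using q1 by simp
  qed
  show "3 + p - q + p * q \<noteq> 0"
  proof
    assume "3 + p - q + p * q = 0"
    then have "(3 * (q\<^sup>2 - 1) + w - q\<^sup>2) + (w - q\<^sup>2) * q = 0" using pk by algebra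
    then have "3 * (q\<^sup>2 - 1) + w - q\<^sup>2 = 0 \<and> w - q\<^sup>2 = 0" using rat q2rat by (intro irr) simp_all
    then show False using q1 by simp
  qed
  have "p = w / (q\<^sup>2 - 1) - (s / (q\<^sup>2 - 1)) * sqrt 2"
    by (simp add: p_def diff_divide_distrib q_def)
  then show "p \<in> Q_sqrt2" using rat q2rat
    by (simp only:) (intro Q_sqrt2_diff Q_sqrt2_Rats Q_sqrt2_mult_sqrt2 Rats_divide Rats_diff Rats_1)
qed

section \<open>Infinitely many rational points on the quartic\<close>

text \<open>The triple \<open>(a, b, c)\<close> stands for the point \<open>s = b/(2a)\<close>, \<open>w = c/(2a\<^sup>2)\<close> of the quartic. In terms of
  \<open>q = s\<surd>2\<close> the map is \<open>q \<mapsto> (3 - q\<^sup>4)/(2qw)\<close>; it lifts, along \<open>X = q\<^sup>2\<close>, the duplication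
  \<open>X \<mapsto> ((X\<^sup>2 - 3)/(2Y))\<^sup>2\<close> on the elliptic curve \<open>Y\<^sup>2 = X(X\<^sup>2 - 3X + 3)\<close>, with \<open>Y = qw\<close>.\<close>

fun curve_double :: "int \<times> int \<times> int \<Rightarrow> int \<times> int \<times> int" where
  "curve_double (a, b, c) = (2 * a * b * c, 12 * a ^ 4 - b ^ 4,
     b ^ 8 - 12 * a\<^sup>2 * b ^ 6 + 72 * a ^ 4 * b ^ 4 - 144 * a ^ 6 * b\<^sup>2 + 144 * a ^ 8)"

text \<open>The orbit starts at \<open>s = 1/4\<close>, \<open>w = 13/8\<close>, the double of \<open>(s, w) = (1, -1)\<close>: from there on \<open>b\<close> and \<open>c\<close>
  are odd, and because \<open>a\<close> becomes \<open>2abc\<close>, its 2-adic valuation grows by exactly one in each step.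
  This makes the orbit infinite.\<close>

lemma curve_double_orbit:
  assumes "((curve_double ^^ n) (2, 1, 13)) = (a, b, c)"
  shows "c\<^sup>2 = b ^ 4 - 6 * a\<^sup>2 * b\<^sup>2 + 12 * a ^ 4 \<and> odd b \<and> odd c \<and> (\<exists>e. odd e \<and> a = 2 ^ Suc n * e)"
  using assms
proof (induction n arbitrary: a b c)
  case 0
  then have "a = 2" "b = 1" "c = 13" by simp_all
  then show ?case by (auto intro!: exI[of _ 1])
next
  case (Suc n)
  obtain a' b' c' where prev: "(curve_double ^^ n) (2, 1, 13) = (a', b', c')" by (metis prod_cases3)
  note IH = Suc.IH[OF prev]
  have now: "a = 2 * a' * b' * c'" "b = 12 * a' ^ 4 - b' ^ 4"
    "c = b' ^ 8 - 12 * a'\<^sup>2 * b' ^ 6 + 72 * a' ^ 4 * b' ^ 4 - 144 * a' ^ 6 * b'\<^sup>2 + 144 * a' ^ 8"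
    using Suc.prems prev by simp_all
  have "c\<^sup>2 = b ^ 4 - 6 * a\<^sup>2 * b\<^sup>2 + 12 * a ^ 4"
  proof -
    \<comment> \<open>Only the squares of \<open>a'\<close>, \<open>b'\<close>, \<open>c'\<close> occur; using them halves the degree of the identity.\<close>
    define u v where "u = a'\<^sup>2" and "v = b'\<^sup>2"
    have c': "c'\<^sup>2 = v\<^sup>2 - 6 * u * v + 12 * u\<^sup>2"
      using IH by (simp add: u_def v_def)
    have a: "a\<^sup>2 = 4 * u * v * c'\<^sup>2" by (simp add: now u_def v_def power_mult_distrib)
    have b: "b = 12 * u\<^sup>2 - v\<^sup>2" by (simp add: now u_def v_def)
    have c: "c = v ^ 4 - 12 * u * v ^ 3 + 72 * u\<^sup>2 * v\<^sup>2 - 144 * u ^ 3 * v + 144 * u ^ 4"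
      by (simp add: now u_def v_def power_mult[symmetric])
    have "c\<^sup>2 = b ^ 4 - 6 * (4 * u * v * (v\<^sup>2 - 6 * u * v + 12 * u\<^sup>2)) * b\<^sup>2
        + 12 * (4 * u * v * (v\<^sup>2 - 6 * u * v + 12 * u\<^sup>2))\<^sup>2"
      unfolding b c by algebra
    then show ?thesis unfolding c'[symmetric] a[symmetric] by simp
  qed
  moreover have "odd b" "odd c" using IH by (simp_all add: now)
  moreover obtain e where e: "odd e" "a' = 2 ^ Suc n * e" using IH by blast
  have "odd (e * b' * c')" "a = 2 ^ Suc (Suc n) * (e * b' * c')"
    using IH e by (simp_all add: now)
  ultimately show ?case by blast
qed

lemma infinite_rational_points:
  "infinite {s :: real. s \<in> \<rat> \<and> s \<noteq> 0 \<and> (\<exists>w\<in>\<rat>. w\<^sup>2 = 4 * s ^ 4 - 6 * s\<^sup>2 + 3)}"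
    (is "infinite ?S")
proof -
  define orb where "orb n = (curve_double ^^ n) (2, 1, 13)" for n
  define f where "f n = (case orb n of (a, b, c) \<Rightarrow> real_of_int b / (2 * real_of_int a))" for n
  have "f n \<in> ?S" for n
  proof -
    obtain a b c where abc: "orb n = (a, b, c)" by (metis prod_cases3)
    have D: "c\<^sup>2 = b ^ 4 - 6 * a\<^sup>2 * b\<^sup>2 + 12 * a ^ 4" "odd b" "a \<noteq> 0"
      using curve_double_orbit[OF abc[unfolded orb_def]] by auto
    have f: "f n = b / (2 * a)" by (simp add: f_def abc)
    have "b \<noteq> 0" using D by auto
    have c2: "(real_of_int c)\<^sup>2 = real_of_int b ^ 4 - 6 * (real_of_int a)\<^sup>2 * (real_of_int b)\<^sup>2 + 12 * real_of_int a ^ 4"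
      using arg_cong[OF D(1), of real_of_int] by simp
    define t w where "t = f n" and "w = c / (2 * real_of_int a ^ 2)"
    have "t * (2 * real_of_int a) = b" "w * (2 * real_of_int a ^ 2) = c"
      using D(3) by (simp_all add: f t_def w_def)
    with c2 have "4 * real_of_int a ^ 4 * w\<^sup>2 = 4 * real_of_int a ^ 4 * (4 * t ^ 4 - 6 * t\<^sup>2 + 3)"
      by algebra
    then have "w\<^sup>2 = 4 * t ^ 4 - 6 * t\<^sup>2 + 3"
      using D(3) by simp
    moreover have "w \<in> \<rat>" "t \<in> \<rat>" "t \<noteq> 0"
      using \<open>a \<noteq> 0\<close> \<open>b \<noteq> 0\<close> by (simp_all add: w_def t_def f)
    ultimately show ?thesis unfolding t_def by blast
  qed
  then have "range f \<subseteq> ?S" by (rule image_subsetI)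
  moreover have "inj f"
  proof (rule linorder_injI)
    fix m n :: nat assume "m < n"
    show "f m \<noteq> f n"
    proof
      assume eq: "f m = f n"
      obtain a b c where abc: "orb m = (a, b, c)" by (metis prod_cases3)
      obtain a' b' c' where abc': "orb n = (a', b', c')" by (metis prod_cases3)
      obtain e where e: "odd b" "odd e" "a = 2 ^ Suc m * e"
        using curve_double_orbit[OF abc[unfolded orb_def]] by auto
      obtain e' where e': "odd b'" "odd e'" "a' = 2 ^ Suc n * e'"
        using curve_double_orbit[OF abc'[unfolded orb_def]] by auto
      have "a \<noteq> 0" "a' \<noteq> 0" using e e' by auto
      then have "real_of_int (b * a') = real_of_int (b' * a)"
        using eq by (simp add: f_def abc abc' field_simps)
      then have "b * a' = b' * a" by linarith
      moreover have "(2 :: int) ^ Suc n = 2 ^ Suc m * 2 ^ (n - m)"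
        using \<open>m < n\<close> by (simp flip: power_add)
      \<comment> \<open>Equal values would give the odd number \<open>b' * e\<close> a factor \<open>2 ^ (n - m)\<close>.\<close>
      ultimately have "2 ^ Suc m * (2 ^ (n - m) * (b * e')) = 2 ^ Suc m * (b' * e)"
        unfolding e(3) e'(3) by (simp only: mult_ac)
      then have "2 ^ (n - m) * (b * e') = b' * e" by simp
      moreover have "even (2 ^ (n - m) * (b * e'))" using \<open>m < n\<close> by simp
      ultimately show False using e e' by simp
    qed
  qed
  ultimately show ?thesis using infinite_super range_inj_infinite by blast
qed

section \<open>The theorem\<close>

theorem mainTheorem6:
  fixes A B C :: "real^2"
  assumes "\<not> collinear {A, B, C}"
  shows "infinite {P. P \<notin> extended_sides A B C \<and>
           P \<notin> extended_sides (inv (complement_map A B C) A)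
                 (inv (complement_map A B C) B) (inv (complement_map A B C) C) \<and>
           (\<exists>x\<in>Q_sqrt2. \<exists>y\<in>Q_sqrt2. \<exists>z\<in>Q_sqrt2. barycentric A B C P x y z) \<and>
           translation (M_map A B C P)}"
    (is "infinite ?Good")
proof -
  have d: "cross2 (B - A) (C - A) \<noteq> 0" by (rule cross2_nonzero_if_not_collinear[OF assms])
  define Good where "Good = ?Good"
  define S where "S = {s :: real. s \<in> \<rat> \<and> s \<noteq> 0 \<and> (\<exists>w\<in>\<rat>. w\<^sup>2 = 4 * s ^ 4 - 6 * s\<^sup>2 + 3)}"
  \<comment> \<open>\<open>Q s x y z\<close> records that \<open>q = s\<surd>2\<close>; as \<open>q\<close> depends on \<open>(x : y : z)\<close> only, \<open>P\<close> determines \<open>s\<close>.\<close>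
  define Q where "Q s x y z \<longleftrightarrow> x + y + z \<noteq> 0 \<and> z + x \<noteq> 0 \<and> s * sqrt 2 * (z + x) = z - x" 
    for s x y z :: real
  have "\<exists>P. P \<in> Good \<and> (\<exists>x y z. P = Ordinary (bary_point A B C x y z) \<and> Q s x y z)" if "s \<in> S" for s
  proof -
    obtain w where w: "w \<in> \<rat>" "w\<^sup>2 = 4 * s ^ 4 - 6 * s\<^sup>2 + 3" and s: "s \<in> \<rat>" "s \<noteq> 0"
      using \<open>s \<in> S\<close> unfolding S_def by blast
    define q where "q = s * sqrt 2"
    define p where "p = (w - q) / (q\<^sup>2 - 1)"
    note C = curve_point[OF s(1) w(1) s(2) w(2), folded q_def, folded p_def]
    have qQ: "q \<in> Q_sqrt2" using s by (simp add: q_def Q_sqrt2_mult_sqrt2)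
    have pm: "1 - p \<noteq> 0" "1 + p \<noteq> 0" "1 - q \<noteq> 0" "1 + q \<noteq> 0"
      using C(3,4) by (auto simp: power2_eq_1_iff)
    \<comment> \<open>Solve \<open>y : z = (1 + p) : (1 - p)\<close> and \<open>z : x = (1 + q) : (1 - q)\<close> without denominators.\<close>
    define x y z where xyz: "x = (1 - q) * (1 - p)" "y = (1 + q) * (1 + p)" "z = (1 + q) * (1 - p)"
    have inQ: "x \<in> Q_sqrt2" "y \<in> Q_sqrt2" "z \<in> Q_sqrt2"
      using qQ C(1) Q_sqrt2_Rats[of 1] by (simp_all add: xyz Q_sqrt2_mult Q_sqrt2_add Q_sqrt2_diff)
    have nz: "x \<noteq> 0" "y \<noteq> 0" "z \<noteq> 0" using pm by (simp_all add: xyz)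
    have sm: "y + z = 2 * (1 + q)" "z + x = 2 * (1 - p)" "x + y = 2 * (1 + p * q)"
      by (simp_all add: xyz algebra_simps)
    have sums: "y + z \<noteq> 0" "z + x \<noteq> 0" "x + y \<noteq> 0" using pm C(5) by (simp_all add: sm)
    have "x + y + z = 3 + q - p + p * q" by (simp add: xyz algebra_simps)
    with C(6) have tot: "x + y + z \<noteq> 0" by simp
    have "x * y + y * z + z * x = (1 + q) * (1 - p) * (3 + p - q + p * q)" 
      unfolding xyz by algebra
    with C(7) pm have tot': "x * y + y * z + z * x \<noteq> 0" by simp
    have p: "p = (y - z) / (y + z)" using pm unfolding sm by (simp add: xyz field_simps)
    have q: "q = (z - x) / (z + x)" using pm unfolding sm by (simp add: xyz field_simps)
    define r where "r = - (p + q) / (1 + p * q)"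
    have r: "r = (x - y) / (x + y)" using C(5) unfolding sm r_def by (simp add: xyz field_simps)
    have "r * (1 + p * q) = - (p + q)" using C(5) by (simp add: r_def)
    then have "(1 + p * q) * (p * q + q * r + r * p + 3) = 0" using C(2) by algebra
    then have "p * q + q * r + r * p = -3" using C(5) by simp
    note tr = translation_M_map[OF d tot nz tot' sums p q r this]
    have "barycentric A B C (Ordinary (bary_point A B C x y z)) x y z"
      using tot by (simp add: barycentric_bary_point)
    then have "Ordinary (bary_point A B C x y z) \<in> Good"
      unfolding Good_def using tr not_on_extended_sides[OF d tot nz] not_on_anticomplementary_sides[OF d tot sums] inQ by blast
    moreover have "Q s x y z" using tot sums q by (simp add: Q_def q_def)
    ultimately show ?thesis by blast
  qed
  then obtain g where g: "g s \<in> Good \<and> (\<exists>x y z. g s = Ordinary (bary_point A B C x y z) \<and> Q s x y z)"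
    if "s \<in> S" for s
    using bchoice[of S "\<lambda>s P. P \<in> Good \<and> (\<exists>x y z. P = Ordinary (bary_point A B C x y z) \<and> Q s x y z)"]
    by blast
  have "inj_on g S"
  proof (rule inj_onI)
    fix s t assume st: "s \<in> S" "t \<in> S" "g s = g t"
    obtain x y z where 1: "g s = Ordinary (bary_point A B C x y z)" "Q s x y z" using g st by blast
    obtain x' y' z' where 2: "g t = Ordinary (bary_point A B C x' y' z')" "Q t x' y' z'" using g st by blast
    have "bary_point A B C x y z = bary_point A B C x' y' z'" using 1(1) 2(1) st(3) by simp
    moreover have "x + y + z \<noteq> 0" "x' + y' + z' \<noteq> 0" using 1(2) 2(2) by (simp_all add: Q_def)
    ultimately obtain c where c: "c \<noteq> 0" "x' = c * x" "z' = c * z"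
      using bary_point_proportional[OF d] by metis
    have "t * sqrt 2 * (z' + x') = z' - x'" using 2(2) by (simp add: Q_def)
    then have "c * (t * sqrt 2 * (z + x)) = c * (z - x)" unfolding c by (simp only: algebra_simps)
    then have "t * sqrt 2 * (z + x) = s * sqrt 2 * (z + x)" using 1(2) c(1) by (simp add: Q_def)
    then show "s = t" using 1(2) by (simp add: Q_def)
  qed
  moreover have "infinite S" unfolding S_def by (rule infinite_rational_points)
  ultimately have "infinite (g ` S)" by (simp add: finite_image_iff)
  moreover have "g ` S \<subseteq> Good" using g by blast
  ultimately have "infinite Good" using infinite_super[of "g ` S" Good] by simp
  then show ?thesis unfolding Good_def .
qed

end
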